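(* Let $\Omega\subset\mathbb{R}^2$ be a compact and convex region whose boundary $\partial\Omega$ is a piecewise smooth Jordan curve, and let $R$ be the rectangle with horizontal and vertical sides that circumscribes $\Omega$. Let $F:\Omega\to\mathbb{R}$ be a continuous function of mixed monotonicity. Suppose that $\mathbf{r}:[0,1]\to\partial\Omega$ is a counterclockwise, piecewise regular parametrization of $\partial\Omega$ such that $f:=F\circ\mathbf{r}$ is differentiable on $[0,1]$ and $f'$ has only finitely many zeros. Then $F$ admits a nice extension $\widetilde{F}$ on $R$.
   Context: A function $F(x,y)$ on a planar domain is of mixed monotonicity if it is non-decreasing in one of its two variables and non-increasing in the other; $F(\uparrow,\downarrow)$ means non-decreasing in the first and non-increasing in the second variable, and $F(\downarrow,\uparrow)$ means non-increasing in the first and non-decreasing in the second. A regular curve is a curve whose derivative exists and is non-zero at every point; a curve is piecewise regular if it is a finite concatenation of regular pieces. Given a continuous $F$ of mixed monotonicity on $\Omega$, a continuous function $\widetilde{F}$ on a larger set containing $\Omega$ is called an extension of $F$ if $\widetilde{F}(X)=F(X)$ for all $X\in\Omega$ and $\widetilde{F}$ has the same mixed monotonicity as $F$ (that is, $\widetilde F(\uparrow,\downarrow)$ if $F(\uparrow,\downarrow)$, and $\widetilde F(\downarrow,\uparrow)$ if $F(\downarrow,\uparrow)$). The extension is called nice if the range of $\widetilde{F}$ coincides with the range of $F$. The rectangle circumscribing $\Omega$ is the smallest rectangle with horizontal and vertical sides containing $\Omega$. *)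

theory Defs
  imports "HOL-Complex_Analysis.Winding_Numbers"
begin

definition mono_up_down :: "(real \<times> real \<Rightarrow> real) \<Rightarrow> (real \<times> real) set \<Rightarrow> bool" where
  "mono_up_down F S \<longleftrightarrow>
     (\<forall>x x' y. (x, y) \<in> S \<longrightarrow> (x', y) \<in> S \<longrightarrow> x \<le> x' \<longrightarrow> F (x, y) \<le> F (x', y)) \<and>
     (\<forall>x y y'. (x, y) \<in> S \<longrightarrow> (x, y') \<in> S \<longrightarrow> y \<le> y' \<longrightarrow> F (x, y') \<le> F (x, y))"

definition mono_down_up :: "(real \<times> real \<Rightarrow> real) \<Rightarrow> (real \<times> real) set \<Rightarrow> bool" where
  "mono_down_up F S \<longleftrightarrow>
     (\<forall>x x' y. (x, y) \<in> S \<longrightarrow> (x', y) \<in> S \<longrightarrow> x \<le> x' \<longrightarrow> F (x', y) \<le> F (x, y)) \<and>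
     (\<forall>x y y'. (x, y) \<in> S \<longrightarrow> (x, y') \<in> S \<longrightarrow> y \<le> y' \<longrightarrow> F (x, y) \<le> F (x, y'))"

definition mixed_monotone :: "(real \<times> real \<Rightarrow> real) \<Rightarrow> (real \<times> real) set \<Rightarrow> bool" where
  "mixed_monotone F S \<longleftrightarrow> mono_up_down F S \<or> mono_down_up F S"

definition is_extension ::
  "(real \<times> real \<Rightarrow> real) \<Rightarrow> (real \<times> real) set \<Rightarrow> (real \<times> real \<Rightarrow> real) \<Rightarrow> (real \<times> real) set \<Rightarrow> bool" where
  "is_extension G R F S \<longleftrightarrow>
     S \<subseteq> R \<and> continuous_on R G \<and> (\<forall>X\<in>S. G X = F X) \<and>
     (mono_up_down F S \<longrightarrow> mono_up_down G R) \<and>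
     (mono_down_up F S \<longrightarrow> mono_down_up G R)"

definition nice_extension ::
  "(real \<times> real \<Rightarrow> real) \<Rightarrow> (real \<times> real) set \<Rightarrow> (real \<times> real \<Rightarrow> real) \<Rightarrow> (real \<times> real) set \<Rightarrow> bool" where
  "nice_extension G R F S \<longleftrightarrow> is_extension G R F S \<and> G ` R = F ` S"

definition axis_rectangle :: "(real \<times> real) set \<Rightarrow> bool" where
  "axis_rectangle R \<longleftrightarrow> (\<exists>a b c d. a < b \<and> c < d \<and> R = {a..b} \<times> {c..d})"

definition circumscribes :: "(real \<times> real) set \<Rightarrow> (real \<times> real) set \<Rightarrow> bool" where
  "circumscribes R S \<longleftrightarrow>
     axis_rectangle R \<and> S \<subseteq> R \<and> (\<forall>R'. axis_rectangle R' \<longrightarrow> S \<subseteq> R' \<longrightarrow> R \<subseteq> R')"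

text \<open>On a closed piece, derivatives are one-sided at the two end points.\<close>

definition regular_on :: "(real \<Rightarrow> real \<times> real) \<Rightarrow> real \<Rightarrow> real \<Rightarrow> bool" where
  "regular_on g a b \<longleftrightarrow>
     (\<forall>s\<in>{a..b}. \<exists>v. v \<noteq> 0 \<and> (g has_vector_derivative v) (at s within {a..b}))"

text \<open>Smooth means continuously differentiable with non-vanishing derivative. In contrast,
  \<open>regular_on\<close> does not ask for continuity of the derivative.\<close>

definition smooth_on :: "(real \<Rightarrow> real \<times> real) \<Rightarrow> real \<Rightarrow> real \<Rightarrow> bool" where
  "smooth_on g a b \<longleftrightarrow>
     (\<exists>g'. continuous_on {a..b} g' \<and>
        (\<forall>s\<in>{a..b}. g' s \<noteq> 0 \<and> (g has_vector_derivative g' s) (at s within {a..b})))"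

definition piecewise ::
  "((real \<Rightarrow> real \<times> real) \<Rightarrow> real \<Rightarrow> real \<Rightarrow> bool) \<Rightarrow> (real \<Rightarrow> real \<times> real) \<Rightarrow> bool" where
  "piecewise P g \<longleftrightarrow>
     (\<exists>(n::nat) t. t 0 = 0 \<and> t n = 1 \<and>
        (\<forall>i<n. t i < t (Suc i) \<and> P g (t i) (t (Suc i))))"

definition jordan_parametrization :: "(real \<Rightarrow> real \<times> real) \<Rightarrow> (real \<times> real) set \<Rightarrow> bool" where
  "jordan_parametrization g C \<longleftrightarrow>
     simple_path g \<and> pathfinish g = pathstart g \<and> path_image g = C"

definition piecewise_smooth_jordan_curve :: "(real \<times> real) set \<Rightarrow> bool" where
  "piecewise_smooth_jordan_curve C \<longleftrightarrow>
     (\<exists>g. jordan_parametrization g C \<and> piecewise smooth_on g)"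

definition to_complex :: "real \<times> real \<Rightarrow> complex" where
  "to_complex X = Complex (fst X) (snd X)"

text \<open>Orientation of a simple closed curve, via its winding number about the enclosed points.\<close>

definition counterclockwise :: "(real \<Rightarrow> real \<times> real) \<Rightarrow> bool" where
  "counterclockwise g \<longleftrightarrow>
     (\<forall>X\<in>inside (path_image g). winding_number (to_complex \<circ> g) (to_complex X) = 1)"

end

theory Submission
  imports Defs
begin

text \<open>In an interior box of \<open>\<Omega>\<close> one may move first horizontally and then vertically, so \<open>F\<close> is
  monotone for the product order there; Bolzano's lemma propagates this along segments, and
  continuity to all of \<open>\<Omega>\<close>. If \<open>d z w\<close> measures by how much \<open>z\<close> fails to lie below \<open>w\<close> in that
  order, compactness yields for each \<open>e > 0\<close> a constant \<open>K\<close> with \<open>F z - F w \<le> e + K * d z w\<close> on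
  \<open>\<Omega>\<close>. As in the McShane--Whitney extension, the infimum of \<open>F w + e + K * d z w\<close> over all
  \<open>w \<in> \<Omega>\<close> and all such pairs \<open>(e, K)\<close> is continuous and monotone in \<open>z\<close> and agrees with \<open>F\<close>
  on \<open>\<Omega>\<close>; cutting it off at the maximum of \<open>F\<close> makes it nice.\<close>

section \<open>McShane-type extension for functions monotone with respect to an asymmetric
  distance\<close>

text \<open>Pairs with \<open>F z - F w < e\<close> satisfy the bound with any
  \<open>K \<ge> 0\<close>. The remaining pairs form a compact set \<open>T\<close> on which
  \<open>d\<close> cannot vanish by \<open>mono\<close>, so \<open>d\<close> has a positive minimum
  there; \<open>K\<close> is the largest value of \<open>F z - F w\<close> on \<open>T\<close>
  divided by that minimum.\<close>

lemma quasi_Lipschitz_bound: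
  fixes F :: "'a::metric_space \<Rightarrow> real" and d :: "'a \<Rightarrow> 'a \<Rightarrow> real"
  assumes S: "compact S" and F: "continuous_on S F"
    and d: "continuous_on (S \<times> S) (\<lambda>x. d (fst x) (snd x))"
    and nonneg: "\<And>z w. 0 \<le> d z w"
    and mono: "\<And>z w. z \<in> S \<Longrightarrow> w \<in> S \<Longrightarrow> d z w = 0 \<Longrightarrow> F z \<le> F w"
    and e: "e > 0"
  obtains K where "K \<ge> 0" "\<And>z w. z \<in> S \<Longrightarrow> w \<in> S \<Longrightarrow> F z - F w \<le> e + K * d z w"
proof -
  define D where "D = (\<lambda>x. F (fst x) - F (snd x))"
  define T where "T = {x \<in> S \<times> S. e \<le> D x}"
  have SS: "compact (S \<times> S)" by (rule compact_Times[OF S S])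
  have D: "continuous_on (S \<times> S) D"
    unfolding D_def
    by (intro continuous_intros continuous_on_compose2[OF F]) auto
  have T: "compact T"
  proof -
    have "closed T"
      unfolding T_def
      by (rule continuous_on_closed_Collect_le[OF continuous_on_const D compact_imp_closed[OF SS]])
    then have "compact (S \<times> S \<inter> T)" by (rule compact_Int_closed[OF SS])
    also have "S \<times> S \<inter> T = T" by (auto simp: T_def)
    finally show ?thesis .
  qed
  show thesis
  proof (cases "T = {}")
    case True
    show thesis
      by (rule that[of 0]) (use True in \<open>force simp: T_def D_def\<close>)+
  next
    case False
    have TS: "T \<subseteq> S \<times> S" by (auto simp: T_def)
    obtain x where x: "x \<in> T" "\<And>y. y \<in> T \<Longrightarrow> d (fst x) (snd x) \<le> d (fst y) (snd y)"
      using continuous_attains_inf[OF T False continuous_on_subset[OF d TS]] by blast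
    obtain m where m: "m \<in> T" "\<And>y. y \<in> T \<Longrightarrow> D y \<le> D m"
      using continuous_attains_sup[OF T False continuous_on_subset[OF D TS]] by blast
    define \<delta> where "\<delta> = d (fst x) (snd x)"
    have "\<delta> \<noteq> 0"
      using mono[of "fst x" "snd x"] x(1) e by (auto simp: T_def D_def \<delta>_def)
    then have \<delta>: "\<delta> > 0" using nonneg[of "fst x" "snd x"] by (simp add: \<delta>_def)
    have Dm: "D m > 0" using m(1) e by (auto simp: T_def)
    show thesis
    proof (rule that[of "D m / \<delta>"])
      show "D m / \<delta> \<ge> 0" using \<delta> Dm by simp
      fix z w assume zw: "z \<in> S" "w \<in> S"
      show "F z - F w \<le> e + D m / \<delta> * d z w"
      proof (cases "(z, w) \<in> T")
        case True
        have "F z - F w \<le> D m" using m(2)[OF True] by (simp add: D_def)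
        also have "\<dots> = D m / \<delta> * \<delta>" using \<delta> by simp
        also have "\<dots> \<le> D m / \<delta> * d z w"
          by (intro mult_left_mono) (use x(2)[OF True] \<delta> Dm in \<open>auto simp: \<delta>_def\<close>)
        finally show ?thesis using e by simp
      next
        case False
        then have "F z - F w \<le> e" using zw by (auto simp: T_def D_def)
        moreover have "0 \<le> D m / \<delta> * d z w" using \<delta> Dm nonneg by simp
        ultimately show ?thesis by linarith
      qed
    qed
  qed
qed

text \<open>Here \<open>d z w = 0\<close> plays the role of "z lies below w", and \<open>tri\<close>
  merges the triangle inequality with Lipschitz dependence on the first argument. The last
  conclusion is the order monotonicity of \<open>G\<close>, phrased through \<open>d\<close>
  alone.\<close>

lemma quasi_metric_extension:
  fixes F :: "'a::metric_space \<Rightarrow> real" and d :: "'a \<Rightarrow> 'a \<Rightarrow> real"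
  assumes S: "compact S" "S \<noteq> {}" and F: "continuous_on S F"
    and d: "continuous_on (S \<times> S) (\<lambda>x. d (fst x) (snd x))"
    and nonneg: "\<And>z w. 0 \<le> d z w" and refl: "\<And>z. d z z = 0"
    and L: "L \<ge> 0" and tri: "\<And>z z' w. d z w \<le> L * dist z z' + d z' w"
    and mono: "\<And>z w. z \<in> S \<Longrightarrow> w \<in> S \<Longrightarrow> d z w = 0 \<Longrightarrow> F z \<le> F w"
  obtains G p q where "continuous_on UNIV G" "\<And>z. z \<in> S \<Longrightarrow> G z = F z"
    "p \<in> S" "q \<in> S" "\<And>z. F p \<le> G z" "\<And>z. G z \<le> F q"
    "\<And>z z'. (\<And>w. d z w \<le> d z' w) \<Longrightarrow> G z \<le> G z'"
proof -
  obtain p where p: "p \<in> S" "\<And>w. w \<in> S \<Longrightarrow> F p \<le> F w"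
    using continuous_attains_inf[OF S F] by blast
  obtain q where q: "q \<in> S" "\<And>w. w \<in> S \<Longrightarrow> F w \<le> F q"
    using continuous_attains_sup[OF S F] by blast
  \<comment> \<open>All admissible pairs are kept: arbitrarily small \<open>e\<close> makes
    \<open>G\<close> agree with \<open>F\<close> on \<open>S\<close>, and each single pair bounds
    the oscillation of \<open>G\<close>.\<close>
  define P where "P = {(e, K). e > 0 \<and> K \<ge> 0 \<and> (\<forall>z\<in>S. \<forall>w\<in>S. F z - F w \<le> e + K * d z w)}"
  have P_ex: "\<exists>K. (e, K) \<in> P" if "e > 0" for e
    using quasi_Lipschitz_bound[OF S(1) F d nonneg mono that]
    unfolding P_def by (smt (verit, del_insts) case_prodI mem_Collect_eq that)
  define V where "V z = {F w + e + K * d z w |w e K. w \<in> S \<and> (e, K) \<in> P}" for z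
  define G where "G z = Inf (V z)" for z
  have V_ne: "V z \<noteq> {}" for z
    using P_ex[of 1] p(1) by (auto simp: V_def)
  have V_ge: "F p \<le> v" if "v \<in> V z" for v z
  proof -
    from that obtain w e K where *: "w \<in> S" "(e, K) \<in> P" "v = F w + e + K * d z w"
      by (auto simp: V_def)
    then have "K * d z w \<ge> 0" "e > 0" using nonneg by (auto simp: P_def)
    with p(2)[OF *(1)] *(3) show ?thesis by linarith
  qed
  have bdd: "bdd_below (V z)" for z
    using V_ge by (auto simp: bdd_below_def)
  have G_ge: "c \<le> G z" if "\<And>w e K. w \<in> S \<Longrightarrow> (e, K) \<in> P \<Longrightarrow> c \<le> F w + e + K * d z w" for c z
    unfolding G_def by (rule cInf_greatest[OF V_ne]) (use that in \<open>auto simp: V_def\<close>)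
  have G_le: "G z \<le> F w + e + K * d z w" if "w \<in> S" "(e, K) \<in> P" for z w e K
    unfolding G_def by (rule cInf_lower[OF _ bdd]) (use that in \<open>auto simp: V_def\<close>)
  \<comment> \<open>Membership in \<open>P\<close> bounds every candidate below by
    \<open>F z\<close>; the choice \<open>w = z\<close> kills the \<open>d\<close> term and leaves
    an excess of only \<open>e\<close>.\<close>
  have G_eq: "G z = F z" if z: "z \<in> S" for z
  proof (rule antisym)
    show "F z \<le> G z"
      by (rule G_ge) (use z in \<open>force simp: P_def\<close>)
    show "G z \<le> F z"
    proof (rule field_le_epsilon)
      fix e :: real assume "e > 0"
      with P_ex obtain K where "(e, K) \<in> P" by blast
      from G_le[OF z this, of z] show "G z \<le> F z + e" by (simp add: refl)
    qed
  qed
  have G_modulus: "G z \<le> G z' + (e + K * (L * dist z z'))" if eK: "(e, K) \<in> P" for z z' e K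
  proof -
    have "G z - (e + K * (L * dist z z')) \<le> G z'"
    proof (rule G_ge)
      fix w e' K' assume w: "w \<in> S" and eK': "(e', K') \<in> P"
      have Kpos: "K \<ge> 0" "K' \<ge> 0" "e > 0" "e' > 0" using eK eK' by (auto simp: P_def)
      have LL: "0 \<le> L * dist z z'" using L by simp
      \<comment> \<open>The pair with the smaller constant serves for the whole distance, so the modulus
        \<open>Inf (e + K * t)\<close> is subadditive in \<open>t\<close>.\<close>
      show "G z - (e + K * (L * dist z z')) \<le> F w + e' + K' * d z' w"
      proof (cases "K \<le> K'")
        case True
        have "G z \<le> F w + e + K * d z w" by (rule G_le[OF w eK])
        also have "K * d z w \<le> K * (L * dist z z') + K * d z' w"
          using mult_left_mono[OF tri Kpos(1)] by (simp add: distrib_left)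
        also have "K * d z' w \<le> K' * d z' w"
          by (rule mult_right_mono[OF True nonneg])
        finally show ?thesis using Kpos by simp
      next
        case False
        have "G z \<le> F w + e' + K' * d z w" by (rule G_le[OF w eK'])
        also have "K' * d z w \<le> K' * (L * dist z z') + K' * d z' w"
          using mult_left_mono[OF tri Kpos(2)] by (simp add: distrib_left)
        also have "K' * (L * dist z z') \<le> K * (L * dist z z')"
          by (rule mult_right_mono) (use False LL in auto)
        finally show ?thesis using Kpos by simp
      qed
    qed
    then show ?thesis by simp
  qed
  have G_cont: "continuous_on UNIV G"
    unfolding continuous_on_iff
  proof (intro ballI allI impI)
    fix z :: 'a and \<epsilon> :: real assume \<epsilon>: "\<epsilon> > 0"
    then obtain K where K: "(\<epsilon>/2, K) \<in> P" using P_ex[of "\<epsilon>/2"] by auto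
    then have KL: "K * L \<ge> 0" using L by (simp add: P_def)
    \<comment> \<open>The \<open>+ 1\<close> keeps the denominator positive when
      \<open>K * L = 0\<close> and makes the estimate below strict.\<close>
    define \<delta> where "\<delta> = \<epsilon> / 2 / (K * L + 1)"
    have "\<delta> > 0" using \<epsilon> KL by (auto simp: \<delta>_def)
    moreover have "dist (G z') (G z) < \<epsilon>" if "dist z' z < \<delta>" for z'
    proof -
      have "K * L * dist z' z \<le> K * L * \<delta>"
        by (rule mult_left_mono) (use that KL in auto)
      also have "\<dots> < (K * L + 1) * \<delta>" using \<open>\<delta> > 0\<close> by (simp add: algebra_simps)
      also have "\<dots> = \<epsilon> / 2" using KL unfolding \<delta>_def by (simp del: divide_divide_eq_left)
      finally have "K * (L * dist z' z) < \<epsilon> / 2" by (simp add: mult.assoc)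
      with G_modulus[OF K, of z z'] G_modulus[OF K, of z' z] show ?thesis
        by (simp add: dist_commute dist_real_def abs_less_iff)
    qed
    ultimately show "\<exists>\<delta>>0. \<forall>z'\<in>UNIV. dist z' z < \<delta> \<longrightarrow> dist (G z') (G z) < \<epsilon>" by blast
  qed
  have G_mono: "G z \<le> G z'" if le: "\<And>w. d z w \<le> d z' w" for z z'
  proof (rule G_ge)
    fix w e K assume w: "w \<in> S" and eK: "(e, K) \<in> P"
    have "K * d z w \<le> K * d z' w"
      by (rule mult_left_mono[OF le]) (use eK in \<open>auto simp: P_def\<close>)
    with G_le[OF w eK, of z] show "G z \<le> F w + e + K * d z' w" by linarith
  qed
  show thesis
  \<comment> \<open>The lower bound \<open>F p\<close> comes from \<open>V_ge\<close>: each
    candidate is a value of \<open>F\<close> plus nonnegative terms.\<close>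
  proof (rule that[of "\<lambda>z. min (G z) (F q)" p q])
    show "continuous_on UNIV (\<lambda>z. min (G z) (F q))"
      by (intro continuous_intros G_cont)
    show "F p \<le> min (G z) (F q)" for z
      using p q V_ge unfolding G_def by (auto intro!: cInf_greatest[OF V_ne])
    show "min (G z) (F q) \<le> min (G z') (F q)" if "\<And>w. d z w \<le> d z' w" for z z'
      using G_mono[OF that] by linarith
  qed (use G_eq p q in auto)
qed

section \<open>Monotonicity in each variable versus the signed product order on convex planar
  sets\<close>

text \<open>The signs of \<open>\<sigma>\<close> and \<open>\<tau>\<close> encode the direction of monotonicity; sign \<open>0\<close> means that the function
  is constant in that variable.\<close>

definition signed_mono :: "real \<Rightarrow> real \<Rightarrow> (real \<times> real \<Rightarrow> real) \<Rightarrow> (real \<times> real) set \<Rightarrow> bool" where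
  "signed_mono \<sigma> \<tau> F S \<longleftrightarrow>
     (\<forall>x x' y. (x, y) \<in> S \<longrightarrow> (x', y) \<in> S \<longrightarrow> \<sigma> * x \<le> \<sigma> * x' \<longrightarrow> F (x, y) \<le> F (x', y)) \<and>
     (\<forall>x y y'. (x, y) \<in> S \<longrightarrow> (x, y') \<in> S \<longrightarrow> \<tau> * y \<le> \<tau> * y' \<longrightarrow> F (x, y) \<le> F (x, y'))"

lemma mono_up_down_iff_signed_mono: "mono_up_down F S \<longleftrightarrow> signed_mono 1 (-1) F S"
  unfolding mono_up_down_def signed_mono_def by auto

lemma mono_down_up_iff_signed_mono: "mono_down_up F S \<longleftrightarrow> signed_mono (-1) 1 F S"
  unfolding mono_down_up_def signed_mono_def by auto

lemma signed_mono_0_iff: "signed_mono 0 0 F S \<longleftrightarrow> mono_up_down F S \<and> mono_down_up F S"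
  unfolding mono_up_down_def mono_down_up_def signed_mono_def
  by simp (smt (verit))

text \<open>The corner of a path made of one horizontal and one vertical step may leave
  \<open>S\<close>, but near an interior point it stays in a box. Both signed coordinates grow along
  the segment from \<open>p\<close> to \<open>q\<close>, so these local comparisons chain together
  by transitivity.\<close>

lemma signed_mono_interior_le:
  fixes S :: "(real \<times> real) set"
  assumes "convex S" and mono: "signed_mono \<sigma> \<tau> F S"
    and pq: "p \<in> interior S" "q \<in> interior S"
    and le: "\<sigma> * fst p \<le> \<sigma> * fst q" "\<tau> * snd p \<le> \<tau> * snd q"
  shows "F p \<le> F q"
proof -
  define \<gamma> where "\<gamma> t = p + t *\<^sub>R (q - p)" for t :: real
  have \<gamma>_mono: "\<sigma> * fst (\<gamma> s) \<le> \<sigma> * fst (\<gamma> t)" "\<tau> * snd (\<gamma> s) \<le> \<tau> * snd (\<gamma> t)" if "s \<le> t" for s t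
  proof -
    have "\<sigma> * fst (\<gamma> u) = \<sigma> * fst p + u * (\<sigma> * fst q - \<sigma> * fst p)"
      "\<tau> * snd (\<gamma> u) = \<tau> * snd p + u * (\<tau> * snd q - \<tau> * snd p)" for u
      by (simp_all add: \<gamma>_def algebra_simps)
    moreover have "s * (\<sigma> * fst q - \<sigma> * fst p) \<le> t * (\<sigma> * fst q - \<sigma> * fst p)"
      "s * (\<tau> * snd q - \<tau> * snd p) \<le> t * (\<tau> * snd q - \<tau> * snd p)"
      by (rule mult_right_mono[OF that]; use le in simp)+
    ultimately show "\<sigma> * fst (\<gamma> s) \<le> \<sigma> * fst (\<gamma> t)" "\<tau> * snd (\<gamma> s) \<le> \<tau> * snd (\<gamma> t)"
      by simp_all
  qed
  have "F (\<gamma> 0) \<le> F (\<gamma> 1)"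
  proof (rule Bolzano[where P = "\<lambda>s t. F (\<gamma> s) \<le> F (\<gamma> t)"])
    fix t :: real assume t: "0 \<le> t" "t \<le> 1"
    have "\<gamma> t = (1 - t) *\<^sub>R p + t *\<^sub>R q" by (simp add: \<gamma>_def algebra_simps)
    then have "\<gamma> t \<in> interior S"
      using convexD_alt[OF convex_interior[OF \<open>convex S\<close>] pq t] by simp
    then obtain A B where AB: "open A" "open B" "\<gamma> t \<in> A \<times> B" "A \<times> B \<subseteq> interior S"
      by (rule open_prod_elim[OF open_interior])
    have "isCont \<gamma> t" unfolding \<gamma>_def by (intro continuous_intros)
    moreover have "open (A \<times> B)" using AB by (simp add: open_Times)
    ultimately have "\<forall>\<^sub>F s in nhds t. \<gamma> s \<in> A \<times> B"
      using AB(3) unfolding isCont_def tendsto_at_iff_tendsto_nhds by (rule topological_tendstoD)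
    then obtain \<delta> where \<delta>: "\<delta> > 0" "\<And>s. dist s t < \<delta> \<Longrightarrow> \<gamma> s \<in> A \<times> B"
      by (auto simp: eventually_nhds_metric)
    have "F (\<gamma> a) \<le> F (\<gamma> b)" if ab: "a \<le> t" "t \<le> b" "b - a < \<delta>" for a b
    proof -
      have in_box: "\<gamma> a \<in> A \<times> B" "\<gamma> b \<in> A \<times> B"
        by (rule \<delta>(2); use ab in \<open>auto simp: dist_real_def\<close>)+
      obtain x y where xy: "\<gamma> a = (x, y)" by fastforce
      obtain x' y' where xy': "\<gamma> b = (x', y')" by fastforce
      \<comment> \<open>The corner \<open>(x', y)\<close> takes one coordinate from each of two
        points of the box, hence lies in it.\<close>
      have S: "(x, y) \<in> S" "(x', y) \<in> S" "(x', y') \<in> S"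
        using in_box AB(4) interior_subset[of S] unfolding xy xy' by auto
      have "\<sigma> * x \<le> \<sigma> * x'" "\<tau> * y \<le> \<tau> * y'"
        using \<gamma>_mono[of a b] ab xy xy' by auto
      then have "F (x, y) \<le> F (x', y)" "F (x', y) \<le> F (x', y')"
        using S mono unfolding signed_mono_def by blast+
      then show ?thesis unfolding xy xy' by linarith
    qed
    with \<delta>(1) show "\<exists>\<delta>>0. \<forall>a b. a \<le> t \<and> t \<le> b \<and> b - a < \<delta> \<longrightarrow> F (\<gamma> a) \<le> F (\<gamma> b)"
      by blast
  qed auto
  then show ?thesis by (simp add: \<gamma>_def)
qed

text \<open>Contracting towards an interior point \<open>c\<close> moves both points into the
  interior and preserves their order, since both undergo the same affine map with nonnegative
  factor. The contraction then tends to the identity.\<close>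

lemma signed_mono_le:
  fixes S :: "(real \<times> real) set"
  assumes S: "convex S" "interior S \<noteq> {}" and cont: "continuous_on S F"
    and mono: "signed_mono \<sigma> \<tau> F S"
    and pq: "p \<in> S" "q \<in> S"
    and le: "\<sigma> * fst p \<le> \<sigma> * fst q" "\<tau> * snd p \<le> \<tau> * snd q"
  shows "F p \<le> F q"
proof -
  obtain c where c: "c \<in> interior S" using S(2) by blast
  \<comment> \<open>\<open>Suc n\<close> keeps the shrinking parameter in (0,1]; for
    \<open>n = 0\<close> the point is \<open>c\<close> itself.\<close>
  define h where "h n z = z - (1 / real (Suc n)) *\<^sub>R (z - c)" for n z
  have int: "h n z \<in> interior S" if "z \<in> S" for n z
    unfolding h_def by (rule mem_interior_convex_shrink[OF S(1) c that]) auto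
  have tends: "(\<lambda>n. F (h n z)) \<longlonglongrightarrow> F z" if z: "z \<in> S" for z
  proof (rule continuous_on_tendsto_compose[OF cont _ z])
    have "(\<lambda>n. h n z) \<longlonglongrightarrow> z - 0 *\<^sub>R (z - c)"
      unfolding h_def by (intro tendsto_intros LIMSEQ_Suc[OF lim_1_over_n])
    then show "(\<lambda>n. h n z) \<longlonglongrightarrow> z" by simp
    show "\<forall>\<^sub>F n in sequentially. h n z \<in> S"
      using int[OF z] interior_subset by (intro always_eventually) blast
  qed
  have "F (h n p) \<le> F (h n q)" for n
  proof (rule signed_mono_interior_le[OF S(1) mono int[OF pq(1)] int[OF pq(2)]])
    define k where "k = 1 / real (Suc n)"
    have "\<sigma> * fst (h n z) = (1 - k) * (\<sigma> * fst z) + k * (\<sigma> * fst c)"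
      "\<tau> * snd (h n z) = (1 - k) * (\<tau> * snd z) + k * (\<tau> * snd c)" for z
      unfolding h_def k_def[symmetric] by (simp_all add: algebra_simps)
    moreover have "0 \<le> 1 - k" by (simp add: k_def)
    ultimately show "\<sigma> * fst (h n p) \<le> \<sigma> * fst (h n q)" "\<tau> * snd (h n p) \<le> \<tau> * snd (h n q)"
      by (simp_all only: add_le_cancel_right mult_left_mono[OF le(1)] mult_left_mono[OF le(2)])
  qed
  then show ?thesis
    by (intro LIMSEQ_le[OF tends[OF pq(1)] tends[OF pq(2)]]) auto
qed

lemma signed_mono_extension:
  fixes S :: "(real \<times> real) set"
  assumes S: "compact S" "convex S" "interior S \<noteq> {}" and cont: "continuous_on S F"
    and mono: "signed_mono \<sigma> \<tau> F S"
  obtains G where "continuous_on UNIV G" "\<And>z. z \<in> S \<Longrightarrow> G z = F z"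
    "signed_mono \<sigma> \<tau> G UNIV" "range G \<subseteq> F ` S"
proof -
  \<comment> \<open>The total excess of the signed coordinates of \<open>z\<close> over those of
    \<open>w\<close>: it vanishes exactly when \<open>z\<close> lies below \<open>w\<close>. A zero
    sign removes its variable from \<open>d\<close>, so \<open>G\<close> becomes constant in
    it.\<close>
  define d where "d z w = max 0 (\<sigma> * fst z - \<sigma> * fst w) + max 0 (\<tau> * snd z - \<tau> * snd w)"
    for z w :: "real \<times> real"
  have "S \<noteq> {}" using S(3) interior_subset by blast
  obtain G p q where G: "continuous_on UNIV G" "\<And>z. z \<in> S \<Longrightarrow> G z = F z"
    "p \<in> S" "q \<in> S" "\<And>z. F p \<le> G z" "\<And>z. G z \<le> F q"
    "\<And>z z'. (\<And>w. d z w \<le> d z' w) \<Longrightarrow> G z \<le> G z'"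
  proof (rule quasi_metric_extension[OF S(1) \<open>S \<noteq> {}\<close> cont, of d])
    show "continuous_on (S \<times> S) (\<lambda>x. d (fst x) (snd x))"
      unfolding d_def by (intro continuous_intros)
    \<comment> \<open>The coordinates are 1-Lipschitz, so the two positive parts contribute
      \<bar>\<sigma>\<bar> and \<bar>\<tau>\<bar> to \<open>L\<close>.\<close>
    show "0 \<le> \<bar>\<sigma>\<bar> + \<bar>\<tau>\<bar>" by simp
    show "d z w \<le> (\<bar>\<sigma>\<bar> + \<bar>\<tau>\<bar>) * dist z z' + d z' w" for z z' w
    proof -
      have bound: "c * (a - b) \<le> \<bar>c\<bar> * dist z z'" if "dist a b \<le> dist z z'" for a b c :: real
      proof -
        have "c * (a - b) \<le> \<bar>c\<bar> * \<bar>a - b\<bar>" by (metis abs_ge_self abs_mult)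
        also have "\<dots> \<le> \<bar>c\<bar> * dist z z'"
          by (rule mult_left_mono) (use that in \<open>simp_all add: dist_real_def\<close>)
        finally show ?thesis .
      qed
      have "\<sigma> * fst z - \<sigma> * fst z' \<le> \<bar>\<sigma>\<bar> * dist z z'" "\<tau> * snd z - \<tau> * snd z' \<le> \<bar>\<tau>\<bar> * dist z z'"
        using bound[OF dist_fst_le, of \<sigma>] bound[OF dist_snd_le, of \<tau>]
        by (simp_all add: right_diff_distrib)
      moreover have "0 \<le> \<bar>\<sigma>\<bar> * dist z z'" "0 \<le> \<bar>\<tau>\<bar> * dist z z'" by simp_all
      ultimately show ?thesis
        unfolding d_def distrib_right by linarith
    qed
    show "F z \<le> F w" if "z \<in> S" "w \<in> S" "d z w = 0" for z w
      by (rule signed_mono_le[OF S(2,3) cont mono that(1,2)])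
        (use that(3) in \<open>unfold d_def, linarith+\<close>)
  qed (auto simp: d_def)
  show thesis
  proof (rule that[OF G(1,2)])
    show "signed_mono \<sigma> \<tau> G UNIV"
      unfolding signed_mono_def by (auto intro!: G(7) simp: d_def)
    \<comment> \<open>A connected set of reals contains everything between its points
      \<open>F p\<close> and \<open>F q\<close>, hence all values of \<open>G\<close>.\<close>
    have "connected (F ` S)"
      by (rule connected_continuous_image[OF cont convex_connected[OF S(2)]])
    then show "range G \<subseteq> F ` S"
      using G(3-6) by (auto intro: connectedD_interval)
  qed
qed

section \<open>Nonempty interior via the Jordan curve theorem\<close>

lemma linear_to_complex: "linear to_complex"
  by (rule linearI) (simp_all add: to_complex_def complex_eq_iff)

lemma inj_to_complex: "inj to_complex"
  by (auto simp: inj_on_def to_complex_def prod_eq_iff)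

text \<open>By the Jordan curve theorem, transported to the complex plane, the curve encloses
  points, whereas a convex set encloses none.\<close>

lemma jordan_parametrization_not_convex:
  assumes "jordan_parametrization g C"
  shows "\<not> convex C"
proof
  assume "convex C"
  have g: "simple_path g" "pathfinish g = pathstart g" "path_image g = C"
    using assms by (auto simp: jordan_parametrization_def)
  have "simple_path (to_complex \<circ> g)"
    using g(1) by (simp add: simple_path_linear_image_eq[OF linear_to_complex inj_to_complex])
  moreover have "pathfinish (to_complex \<circ> g) = pathstart (to_complex \<circ> g)"
    using g(2) by (simp add: pathfinish_compose pathstart_compose)
  moreover have "path_image (to_complex \<circ> g) = to_complex ` C"
    using g(3) by (simp add: path_image_compose)
  ultimately have "inside (to_complex ` C) \<noteq> {}"
    using Jordan_inside_outside[of "to_complex \<circ> g"] by simp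
  moreover have "convex (to_complex ` C)"
    by (rule convex_linear_image[OF linear_to_complex \<open>convex C\<close>])
  ultimately show False by (simp add: inside_convex)
qed

theorem theorem2p1:
  fixes \<Omega> R :: "(real \<times> real) set"
    and F :: "real \<times> real \<Rightarrow> real"
    and r :: "real \<Rightarrow> real \<times> real"
    and f f' :: "real \<Rightarrow> real"
  assumes "compact \<Omega>" and "convex \<Omega>"
    and "piecewise_smooth_jordan_curve (frontier \<Omega>)"
    and "circumscribes R \<Omega>"
    and "continuous_on \<Omega> F" and "mixed_monotone F \<Omega>"
    and "jordan_parametrization r (frontier \<Omega>)"
    and "counterclockwise r" and "piecewise regular_on r"
    and "f = F \<circ> r"
    and "\<And>t. t \<in> {0..1} \<Longrightarrow> (f has_real_derivative f' t) (at t within {0..1})"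
    and "finite {t \<in> {0..1}. f' t = 0}"
  shows "\<exists>F'. nice_extension F' R F \<Omega>"
proof -
  \<comment> \<open>With empty interior, the closed convex set would coincide with its frontier, a
    Jordan curve.\<close>
  have int: "interior \<Omega> \<noteq> {}"
  proof
    assume "interior \<Omega> = {}"
    then have "frontier \<Omega> = \<Omega>"
      using compact_imp_closed[OF assms(1)] by (simp add: frontier_def)
    with jordan_parametrization_not_convex[OF assms(7)] assms(2) show False by simp
  qed
  have sub: "\<Omega> \<subseteq> R" using assms(4) by (simp add: circumscribes_def)
  \<comment> \<open>An extension must inherit every direction of monotonicity that \<open>F\<close>
    has. If \<open>F\<close> has both, signs \<open>0\<close> force \<open>G\<close> to have both as
    well; otherwise the signs follow the single direction.\<close>
  obtain \<sigma> \<tau> where mono: "signed_mono \<sigma> \<tau> F \<Omega>"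
    and up: "\<And>G. mono_up_down F \<Omega> \<Longrightarrow> signed_mono \<sigma> \<tau> G UNIV \<Longrightarrow> mono_up_down G UNIV"
    and down: "\<And>G. mono_down_up F \<Omega> \<Longrightarrow> signed_mono \<sigma> \<tau> G UNIV \<Longrightarrow> mono_down_up G UNIV"
  proof (cases "mono_up_down F \<Omega> \<and> mono_down_up F \<Omega>")
    case True
    show thesis by (rule that[of 0 0]) (use True in \<open>simp_all add: signed_mono_0_iff\<close>)
  next
    case False
    show thesis
    proof (cases "mono_up_down F \<Omega>")
      case True
      with False show thesis
        by (intro that[of 1 "-1"]) (simp_all flip: mono_up_down_iff_signed_mono)
    next
      case False
      with assms(6) have "mono_down_up F \<Omega>" by (simp add: mixed_monotone_def)
      with False show thesis
        by (intro that[of "-1" 1]) (simp_all flip: mono_down_up_iff_signed_mono)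
    qed
  qed
  obtain G where G: "continuous_on UNIV G" "\<And>z. z \<in> \<Omega> \<Longrightarrow> G z = F z"
    "signed_mono \<sigma> \<tau> G UNIV" "range G \<subseteq> F ` \<Omega>"
    using signed_mono_extension[OF assms(1,2) int assms(5) mono] by blast
  have "mono_up_down G R" if "mono_up_down F \<Omega>"
    using up[OF that G(3)] unfolding mono_up_down_def by simp
  moreover have "mono_down_up G R" if "mono_down_up F \<Omega>"
    using down[OF that G(3)] unfolding mono_down_up_def by simp
  moreover have "G ` R = F ` \<Omega>"
  proof
    show "G ` R \<subseteq> F ` \<Omega>" using G(4) by blast
    have "F ` \<Omega> = G ` \<Omega>" by (rule image_cong) (simp_all add: G(2))
    with sub show "F ` \<Omega> \<subseteq> G ` R" by blast
  qed
  ultimately have "nice_extension G R F \<Omega>"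
    using sub G(2) continuous_on_subset[OF G(1) subset_UNIV]
    by (simp add: nice_extension_def is_extension_def)
  then show ?thesis by blast
qed

end
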